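(* The region $\mathcal R$ can be partitioned (up to common boundaries, i.e. $\mathcal R=\bigcup_{\mathbf k\in\mathcal K}\mathbb P_{\mathbf k}$ and the interiors of distinct pieces are disjoint) into polytopes indexed by $\mathbf k\in\mathcal K$, $$\mathbb P_{\mathbf k}=\big\{\mathbf a\in\mathcal R: a_{k_i}\le[\Theta_{\mathbf k}\mathbf a+\boldsymbol\eta_{\mathbf k}]_i\le a_{k_i+1},\ i\in\mathcal N\big\},$$ where $\Theta_{\mathbf k}=D^{-1}A$ and $\boldsymbol\eta_{\mathbf k}=D^{-1}\mathbf 1$ with $A=A_{\mathbf k}$, $D=D_{\mathbf k}$ as in the context. Moreover, for $\mathbf a\in\mathbb P_{\mathbf k}$ the objective function $c$ is convex and is given by $c(\mathbf a)=c_{\mathbf k}(\mathbf a)=\mathbf a'Q_{\mathbf k}\mathbf a+\mathbf b_{\mathbf k}\mathbf a+\tilde b_{\mathbf k}$, with $$Q_{\mathbf k}=\Theta_{\mathbf k}'\Theta_{\mathbf k},\qquad \mathbf b_{\mathbf k}=2(\boldsymbol\eta_{\mathbf k}-\mathbf d^* )'\Theta_{\mathbf k}+\gamma\mathbf 1'(\Theta_{\mathbf k}-I),\qquad \tilde b_{\mathbf k}=(\boldsymbol\eta_{\mathbf k}-\mathbf d^* )'(\boldsymbol\eta_{\mathbf k}-\mathbf d^* )+\gamma\mathbf 1'\boldsymbol\eta_{\mathbf k}.$$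
   Context: $N\ge1$ is an integer, $\mathcal N=\{1,\dots,N\}$, and $\alpha,\beta>0$ satisfy $N<\beta/\alpha+1$. For $\mathbf a\in\mathbb R^N$, the departure vector $\mathbf d(\mathbf a)$ is the unique $\mathbf d$ with $a_i\le d_i$ satisfying $$1=\int_{a_i}^{d_i}\Big[\beta-\alpha\Big(\sum_{j=1}^N \mathbf 1\{t\in[a_j,d_j]\}-1\Big)\Big]dt,\qquad i\in\mathcal N.$$ Given $\mathbf d^*=(d_1^*,\dots,d_N^* )'$ with $d_1^*\le\dots\le d_N^*$ and $\gamma\ge0$, the objective is $c(\mathbf a)=\sum_{i=1}^N[(d_i(\mathbf a)-d_i^* )^2+\gamma(d_i(\mathbf a)-a_i)]$. The search region is $$\mathcal R=\{\mathbf a\in\mathbb R^N:\underline a\le a_1\le\dots\le a_N\le\overline a\},\quad \underline a=d_1^*-\tfrac{N}{\beta-\alpha(N-1)},\quad \overline a=d_N^*+\tfrac{N}{\beta-\alpha(N-1)}.$$ Let $\mathcal K=\{\mathbf k\in\mathcal N^N: k_N=N,\ k_i\le k_j\ \forall i\le j,\ k_i\ge i\ \forall i\}$. For $\mathbf k\in\mathcal K$ put $h_i=\min\{h\in\mathcal N:k_h\ge i\}$ and define $A_{\mathbf k},D_{\mathbf k}\in\mathbb R^{N\times N}$ by $$(A_{\mathbf k})_{ij}=\begin{cases}\beta-\alpha(i-h_i),&i=j,\\-\alpha,&i+1\le j\le k_i,\\0,&\text{otherwise,}\end{cases}\qquad (D_{\mathbf k})_{ij}=\begin{cases}\beta-\alpha(k_i-i),&i=j,\\-\alpha,&h_i\le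 j\le i-1,\\0,&\text{otherwise.}\end{cases}$$ $\mathbf 1$ is the all-ones vector, $I$ the identity matrix, prime denotes transpose, and $a_{N+1}:=+\infty$ (so the upper constraint is void when $k_i=N$). *)

theory Defs
  imports "HOL-Analysis.Analysis"
begin

(* Vectors have type real^'n with 'n finite and linearly ordered: 'n plays the role of
   the index set {1,...,N} and N = CARD('n).  Since 'n is universally quantified, every
   N >= 1 is covered.  Index inequalities are read in the order of 'n; differences of
   indices are differences of the 1-based ranks below. *)

definition first_index :: "'n::{finite,linorder}" where
  "first_index = Min UNIV"

definition last_index :: "'n::{finite,linorder}" where
  "last_index = Max UNIV"

definition index_rank :: "'n::{finite,linorder} \<Rightarrow> nat" where
  "index_rank i = card {j. j \<le> i}"

definition index_diff :: "'n::{finite,linorder} \<Rightarrow> 'n \<Rightarrow> real" where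
  "index_diff i j = real (index_rank i) - real (index_rank j)"

(* The entry of a that follows position m, i.e. a_(m+1), where a_(N+1) is +infinity. *)
definition next_entry :: "real^'n::{finite,linorder} \<Rightarrow> 'n \<Rightarrow> ereal" where
  "next_entry a m = (if m = last_index then \<infinity> else ereal (a $ Min {j. m < j}))"

definition is_departure_vector ::
    "real \<Rightarrow> real \<Rightarrow> real^'n::{finite,linorder} \<Rightarrow> real^'n::{finite,linorder} \<Rightarrow> bool" where
  "is_departure_vector \<alpha> \<beta> a d \<longleftrightarrow>
     (\<forall>i. a $ i \<le> d $ i \<and>
        1 = integral {a $ i..d $ i}
              (\<lambda>t. \<beta> - \<alpha> * ((\<Sum>j\<in>UNIV. indicat_real {a $ j..d $ j} t) - 1)))"

(* Exactly one such d exists when alpha, beta > 0 and CARD('n) < beta/alpha + 1. *)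
definition departure :: "real \<Rightarrow> real \<Rightarrow> real^'n::{finite,linorder} \<Rightarrow> real^'n::{finite,linorder}" where
  "departure \<alpha> \<beta> a = (THE d. is_departure_vector \<alpha> \<beta> a d)"

definition cost ::
    "real \<Rightarrow> real \<Rightarrow> real \<Rightarrow> real^'n::{finite,linorder} \<Rightarrow> real^'n::{finite,linorder} \<Rightarrow> real" where
  "cost \<alpha> \<beta> \<gamma> dstar a =
     (\<Sum>i\<in>UNIV. (departure \<alpha> \<beta> a $ i - dstar $ i)\<^sup>2 + \<gamma> * (departure \<alpha> \<beta> a $ i - a $ i))"

definition search_region ::
    "real \<Rightarrow> real \<Rightarrow> real^'n::{finite,linorder} \<Rightarrow> (real^'n::{finite,linorder}) set" where
  "search_region \<alpha> \<beta> dstar =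
     (let N = real CARD('n);
          lower = dstar $ first_index - N / (\<beta> - \<alpha> * (N - 1));
          upper = dstar $ last_index + N / (\<beta> - \<alpha> * (N - 1))
      in {a. lower \<le> a $ first_index \<and> (\<forall>i j. i \<le> j \<longrightarrow> a $ i \<le> a $ j) \<and> a $ last_index \<le> upper})"

definition K_set :: "('n::{finite,linorder} \<Rightarrow> 'n) set" where
  "K_set = {k. k last_index = last_index \<and> (\<forall>i j. i \<le> j \<longrightarrow> k i \<le> k j) \<and> (\<forall>i. i \<le> k i)}"

definition h_index :: "('n::{finite,linorder} \<Rightarrow> 'n) \<Rightarrow> 'n \<Rightarrow> 'n" where
  "h_index k i = Min {h. i \<le> k h}"

definition A_mat :: "real \<Rightarrow> real \<Rightarrow> ('n::{finite,linorder} \<Rightarrow> 'n) \<Rightarrow> (real^'n::{finite,linorder})^'n::{finite,linorder}" where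
  "A_mat \<alpha> \<beta> k = (\<chi> i j.
     if i = j then \<beta> - \<alpha> * index_diff i (h_index k i)
     else if i < j \<and> j \<le> k i then - \<alpha>
     else 0)"

definition D_mat :: "real \<Rightarrow> real \<Rightarrow> ('n::{finite,linorder} \<Rightarrow> 'n) \<Rightarrow> (real^'n::{finite,linorder})^'n::{finite,linorder}" where
  "D_mat \<alpha> \<beta> k = (\<chi> i j.
     if i = j then \<beta> - \<alpha> * index_diff (k i) i
     else if h_index k i \<le> j \<and> j < i then - \<alpha>
     else 0)"

(* D_mat is lower triangular; for k in K_set and CARD('n) < beta/alpha + 1 its diagonal is
   positive, so matrix_inv is its genuine inverse. *)
definition Theta :: "real \<Rightarrow> real \<Rightarrow> ('n::{finite,linorder} \<Rightarrow> 'n) \<Rightarrow> (real^'n::{finite,linorder})^'n::{finite,linorder}" where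
  "Theta \<alpha> \<beta> k = matrix_inv (D_mat \<alpha> \<beta> k) ** A_mat \<alpha> \<beta> k"

definition eta :: "real \<Rightarrow> real \<Rightarrow> ('n::{finite,linorder} \<Rightarrow> 'n) \<Rightarrow> real^'n::{finite,linorder}" where
  "eta \<alpha> \<beta> k = matrix_inv (D_mat \<alpha> \<beta> k) *v vec 1"

definition piece ::
    "real \<Rightarrow> real \<Rightarrow> real^'n::{finite,linorder} \<Rightarrow> ('n \<Rightarrow> 'n) \<Rightarrow> (real^'n::{finite,linorder}) set" where
  "piece \<alpha> \<beta> dstar k =
     {a \<in> search_region \<alpha> \<beta> dstar.
        \<forall>i. a $ k i \<le> (Theta \<alpha> \<beta> k *v a + eta \<alpha> \<beta> k) $ i \<and>
            ereal ((Theta \<alpha> \<beta> k *v a + eta \<alpha> \<beta> k) $ i) \<le> next_entry a (k i)}"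

definition Q_mat :: "real \<Rightarrow> real \<Rightarrow> ('n::{finite,linorder} \<Rightarrow> 'n) \<Rightarrow> (real^'n::{finite,linorder})^'n::{finite,linorder}" where
  "Q_mat \<alpha> \<beta> k = transpose (Theta \<alpha> \<beta> k) ** Theta \<alpha> \<beta> k"

definition b_vec ::
    "real \<Rightarrow> real \<Rightarrow> real \<Rightarrow> real^'n::{finite,linorder} \<Rightarrow> ('n \<Rightarrow> 'n) \<Rightarrow> real^'n::{finite,linorder}" where
  "b_vec \<alpha> \<beta> \<gamma> dstar k =
     2 *\<^sub>R ((eta \<alpha> \<beta> k - dstar) v* Theta \<alpha> \<beta> k) + \<gamma> *\<^sub>R (vec 1 v* (Theta \<alpha> \<beta> k - mat 1))"

definition b_const ::
    "real \<Rightarrow> real \<Rightarrow> real \<Rightarrow> real^'n::{finite,linorder} \<Rightarrow> ('n \<Rightarrow> 'n) \<Rightarrow> real" where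
  "b_const \<alpha> \<beta> \<gamma> dstar k =
     (eta \<alpha> \<beta> k - dstar) \<bullet> (eta \<alpha> \<beta> k - dstar) + \<gamma> * (vec 1 \<bullet> eta \<alpha> \<beta> k)"

end

theory Submission
  imports Defs
begin

text \<open>The service rate is positive everywhere, so departures occur in the order of arrivals.
  For sorted arrival times the departure condition then reads
  beta (d_i - a_i) - alpha sum_(j > i) (d_i - a_j)^+ - alpha sum_(j < i) (d_j - a_i)^+ = 1,
  a triangular system whose i-th equation is strictly increasing in d_i. Recording, for each i,
  the last arrival k_i before d_i decides the sign of every positive part and turns the system
  into D d = A a + 1, so that d = Theta a + eta on the piece of k.\<close>

text \<open>\<open>departure\<close> is a definite description over all vectors d, sorted or not,
  whereas the triangular system restates the integral condition only for sorted d. Sortedness is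
  therefore derived twice, from the integral condition and from the system, and only then do
  existence and uniqueness transfer from the system to \<open>departure\<close>. The number behind
  all estimates is beta - alpha (N - 1), the service rate with all N present: it is positive by
  assumption and bounds the slope of every scalar equation from below. The pieces can be closed
  because at a tie d_i = a_j the positive part is zero whether it is kept or dropped, so the linear
  systems on both sides of the boundary hold there.\<close>

definition overlap :: "real^'n::{finite,linorder} \<Rightarrow> real^'n::{finite,linorder} \<Rightarrow> 'n \<Rightarrow> 'n \<Rightarrow> real" where
  "overlap a d i j = max 0 (min (d $ i) (d $ j) - max (a $ i) (a $ j))"

definition sorted_vec :: "real^'n::{finite,linorder} \<Rightarrow> bool" where
  "sorted_vec a \<longleftrightarrow> (\<forall>i j. i \<le> j \<longrightarrow> a $ i \<le> a $ j)"

text \<open>A later j shares with i the time from a_j to d_i, an earlier j the time from a_i to d_j.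
  The coefficient is beta rather than beta + alpha because the overlap of i with itself has been
  absorbed.\<close>

definition fifo_system ::
    "real \<Rightarrow> real \<Rightarrow> real^'n::{finite,linorder} \<Rightarrow> real^'n::{finite,linorder} \<Rightarrow> bool" where
  "fifo_system \<alpha> \<beta> a d \<longleftrightarrow>
     (\<forall>i. \<beta> * (d $ i - a $ i) - \<alpha> * (\<Sum>j\<in>{i<..}. max 0 (d $ i - a $ j))
            - \<alpha> * (\<Sum>j\<in>{..<i}. max 0 (d $ j - a $ i)) = 1)"

section \<open>Index order: sortedness, induction, splitting of sums\<close>

lemma sorted_vecD: "sorted_vec a \<Longrightarrow> i \<le> j \<Longrightarrow> a $ i \<le> a $ j"
  by (simp add: sorted_vec_def)

text \<open>Stated for a relation, since it drives both an induction rule and the recursive choice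
  that constructs a solution of the system.\<close>

lemma wf_less_finite: "wf {(i, j :: 'n::{finite,linorder}). i < j}"
proof (rule finite_acyclic_wf)
  have "trans {(i, j :: 'n). i < j}" by (auto simp: trans_def)
  then show "acyclic {(i, j :: 'n). i < j}"
    by (simp add: acyclic_def)
qed (rule finite)

lemma finite_less_induct [case_names less]:
  fixes i :: "'n::{finite,linorder}"
  assumes "\<And>i. (\<And>j. j < i \<Longrightarrow> P j) \<Longrightarrow> P i"
  shows "P i"
  using wf_less_finite by (induction i rule: wf_induct_rule) (auto intro: assms)

lemma UNIV_split_less: "UNIV = {..<i} \<union> {i} \<union> {i<..}" for i :: "'n::linorder"
  by auto

lemma sum_split_less:
  fixes f :: "'n::{finite,linorder} \<Rightarrow> real"
  shows "(\<Sum>j\<in>UNIV. f j) = (\<Sum>j\<in>{..<i}. f j) + f i + (\<Sum>j\<in>{i<..}. f j)"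
proof -
  have "sum f ({..<i} \<union> {i} \<union> {i<..}) = sum f ({..<i} \<union> {i}) + sum f {i<..}"
    by (rule sum.union_disjoint) auto
  also have "sum f ({..<i} \<union> {i}) = sum f {..<i} + sum f {i}"
    by (rule sum.union_disjoint) auto
  finally show ?thesis
    by (simp only: UNIV_split_less[symmetric] sum.insert finite.emptyI sum.empty) simp
qed

text \<open>Source of the constant N - 1: each index interacts with at most N - 1 others.\<close>

lemma card_le_CARD_minus_1:
  fixes J :: "'n::finite set"
  assumes "i \<notin> J"
  shows "real (card J) \<le> real CARD('n) - 1"
proof -
  have "card J < CARD('n)"
    using assms by (intro psubset_card_mono) auto
  then show ?thesis by linarith
qed

section \<open>The departure condition in terms of overlap lengths\<close>

lemma has_integral_indicator_interval:
  fixes p q r s :: real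
  shows "(indicat_real {r..s} has_integral max 0 (min q s - max p r)) {p..q}"
proof -
  \<comment> \<open>If the two intervals are disjoint, this one is empty or a contradictory range,
    and the truncation at 0 gives the correct length.\<close>
  have "((\<lambda>_. 1::real) has_integral max 0 (min q s - max p r)) {max p r..min q s}"
    using has_integral_const_real[of "1::real" "max p r" "min q s"]
    by (simp add: max_def split: if_splits)
  also have "{max p r..min q s} = {r..s} \<inter> {p..q}" by auto
  finally show ?thesis
    by (subst (asm) has_integral_restrict_Int[symmetric])
       (simp add: indicator_def[abs_def] of_bool_def if_distrib cong: if_cong)
qed

text \<open>The integrand is beta + alpha minus alpha times the number present, i included. Each
  indicator integrates over the stay of i to the length of the intersection of two stays, which is
  \<open>overlap\<close>.\<close>

lemma departure_integral:
  fixes a d :: "real^'n::{finite,linorder}"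
  assumes "a $ i \<le> d $ i"
  shows "integral {a $ i..d $ i}
           (\<lambda>t. \<beta> - \<alpha> * ((\<Sum>j\<in>UNIV. indicat_real {a $ j..d $ j} t) - 1)) =
         (\<beta> + \<alpha>) * (d $ i - a $ i) - \<alpha> * (\<Sum>j\<in>UNIV. overlap a d i j)"
proof (rule integral_unique)
  have "((\<lambda>t. \<Sum>j\<in>UNIV. indicat_real {a $ j..d $ j} t) has_integral
          (\<Sum>j\<in>UNIV. overlap a d i j)) {a $ i..d $ i}"
    unfolding overlap_def by (intro has_integral_sum has_integral_indicator_interval) auto
  from has_integral_mult_right[OF this, of \<alpha>]
  have 1: "((\<lambda>t. \<alpha> * (\<Sum>j\<in>UNIV. indicat_real {a $ j..d $ j} t)) has_integral
          \<alpha> * (\<Sum>j\<in>UNIV. overlap a d i j)) {a $ i..d $ i}" .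
  have 2: "((\<lambda>t. \<beta> + \<alpha>) has_integral (\<beta> + \<alpha>) * (d $ i - a $ i)) {a $ i..d $ i}"
    using has_integral_const_real[of "\<beta> + \<alpha>" "a $ i" "d $ i"] assms by (simp add: mult.commute)
  show "((\<lambda>t. \<beta> - \<alpha> * ((\<Sum>j\<in>UNIV. indicat_real {a $ j..d $ j} t) - 1)) has_integral
         (\<beta> + \<alpha>) * (d $ i - a $ i) - \<alpha> * (\<Sum>j\<in>UNIV. overlap a d i j)) {a $ i..d $ i}"
    using has_integral_diff[OF 2 1] by (simp add: algebra_simps)
qed

lemma is_departure_vector_iff_overlap:
  "is_departure_vector \<alpha> \<beta> a d \<longleftrightarrow>
     (\<forall>i. a $ i \<le> d $ i \<and> (\<beta> + \<alpha>) * (d $ i - a $ i) - \<alpha> * (\<Sum>j\<in>UNIV. overlap a d i j) = 1)"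
  unfolding is_departure_vector_def using departure_integral[of a _ d \<beta> \<alpha>] by auto

lemma sum_overlap:
  fixes a d :: "real^'n::{finite,linorder}"
  assumes "sorted_vec a" "sorted_vec d" "\<And>i. a $ i \<le> d $ i"
  shows "(\<Sum>j\<in>UNIV. overlap a d i j) = (\<Sum>j\<in>{..<i}. max 0 (d $ j - a $ i)) + (d $ i - a $ i)
           + (\<Sum>j\<in>{i<..}. max 0 (d $ i - a $ j))"
proof -
  have "(\<Sum>j\<in>{..<i}. overlap a d i j) = (\<Sum>j\<in>{..<i}. max 0 (d $ j - a $ i))"
    using assms(1,2) by (intro sum.cong) (auto simp: overlap_def min_absorb2 max_absorb1 sorted_vecD)
  moreover have "(\<Sum>j\<in>{i<..}. overlap a d i j) = (\<Sum>j\<in>{i<..}. max 0 (d $ i - a $ j))"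
    using assms(1,2) by (intro sum.cong) (auto simp: overlap_def min_absorb1 max_absorb2 sorted_vecD)
  moreover have "overlap a d i i = d $ i - a $ i"
    using assms(3)[of i] by (simp add: overlap_def)
  ultimately show ?thesis by (simp add: sum_split_less[of _ i])
qed

text \<open>If i <= l but d_l < d_i, the stay of i exceeds that of l by some Delta > 0, and each of
  the N overlaps exceeds its counterpart by at most Delta. Subtracting the two equations gives (beta
  + alpha) Delta <= alpha N Delta, against beta > alpha (N - 1).\<close>

lemma is_departure_vector_sorted:
  fixes a d :: "real^'n::{finite,linorder}"
  assumes "\<alpha> > 0" "\<alpha> * (real CARD('n) - 1) < \<beta>" "sorted_vec a" "is_departure_vector \<alpha> \<beta> a d"
  shows "sorted_vec d"
  unfolding sorted_vec_def
proof (intro allI impI)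
  fix i l :: 'n assume "i \<le> l"
  then have al: "a $ i \<le> a $ l" using assms(3) by (simp add: sorted_vecD)
  have eq: "(\<beta> + \<alpha>) * (d $ i - a $ i) - \<alpha> * (\<Sum>j\<in>UNIV. overlap a d i j) = 1" for i
    using assms(4) unfolding is_departure_vector_iff_overlap by blast
  show "d $ i \<le> d $ l"
  proof (rule ccontr)
    assume "\<not> d $ i \<le> d $ l"
    then have dl: "d $ l < d $ i" by simp
    define \<Delta> where "\<Delta> = (d $ i - a $ i) - (d $ l - a $ l)"
    have "\<Delta> > 0" using al dl by (simp add: \<Delta>_def)
    have "(\<Sum>j\<in>UNIV. overlap a d i j - overlap a d l j) \<le> (\<Sum>j\<in>(UNIV::'n set). \<Delta>)"
    proof (rule sum_mono)
      fix j
      have "min (d $ i) (d $ j) \<le> min (d $ l) (d $ j) + (d $ i - d $ l)"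
        using dl by (simp add: min_def)
      moreover have "max (a $ l) (a $ j) - (a $ l - a $ i) \<le> max (a $ i) (a $ j)"
        using al by (simp add: max_def)
      ultimately have "min (d $ i) (d $ j) - max (a $ i) (a $ j) \<le>
          min (d $ l) (d $ j) - max (a $ l) (a $ j) + \<Delta>"
        by (simp add: \<Delta>_def)
      then show "overlap a d i j - overlap a d l j \<le> \<Delta>"
        using \<open>\<Delta> > 0\<close> unfolding overlap_def by (auto simp: max_def)
    qed
    then have "\<alpha> * (\<Sum>j\<in>UNIV. overlap a d i j - overlap a d l j) \<le> \<alpha> * (real CARD('n) * \<Delta>)"
      using assms(1) by (intro mult_left_mono) auto
    moreover have "\<alpha> * (\<Sum>j\<in>UNIV. overlap a d i j - overlap a d l j) = (\<beta> + \<alpha>) * \<Delta>"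
      unfolding sum_subtractf right_diff_distrib \<Delta>_def using eq[of i] eq[of l]
      by (simp only: right_diff_distrib)
    moreover have "(\<alpha> * real CARD('n)) * \<Delta> < (\<beta> + \<alpha>) * \<Delta>"
      using assms(2) \<open>\<Delta> > 0\<close> by (intro mult_strict_right_mono) (auto simp: algebra_simps)
    ultimately show False by (simp add: mult.assoc)
  qed
qed

section \<open>The triangular system: existence, uniqueness and order of its solution\<close>

text \<open>Each positive part has slope at most 1 and at most N - 1 of them occur, so the slope of
  the whole is at least beta - alpha (N - 1). Existence, uniqueness and ordering all rest on this
  estimate.\<close>

lemma sum_pos_part_increment:
  fixes J :: "'n::finite set" and a :: "'n \<Rightarrow> real"
  assumes "\<alpha> \<ge> 0" "i \<notin> J" "x \<le> y"
  shows "(\<beta> - \<alpha> * (real CARD('n) - 1)) * (y - x) \<le>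
    (\<beta> * y - \<alpha> * (\<Sum>j\<in>J. max 0 (y - a j))) - (\<beta> * x - \<alpha> * (\<Sum>j\<in>J. max 0 (x - a j)))"
proof -
  have "(\<Sum>j\<in>J. max 0 (y - a j) - max 0 (x - a j)) \<le> (\<Sum>j\<in>J. y - x)"
    using assms(3) by (intro sum_mono) (auto simp: max_def)
  also have "\<dots> = real (card J) * (y - x)" by simp
  also have "\<dots> \<le> (real CARD('n) - 1) * (y - x)"
    using card_le_CARD_minus_1[OF assms(2)] assms(3) by (intro mult_right_mono) auto
  finally have "\<alpha> * (\<Sum>j\<in>J. max 0 (y - a j) - max 0 (x - a j)) \<le> \<alpha> * ((real CARD('n) - 1) * (y - x))"
    using assms(1) by (intro mult_left_mono)
  then show ?thesis by (simp add: sum_subtractf algebra_simps)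
qed

lemma ex_fifo_system:
  fixes a :: "real^'n::{finite,linorder}"
  assumes "\<alpha> > 0" "\<alpha> * (real CARD('n) - 1) < \<beta>" "sorted_vec a"
  shows "\<exists>d. (\<forall>i. a $ i \<le> d $ i) \<and> fifo_system \<alpha> \<beta> a d"
proof -
  let ?P = "\<lambda>f i r. a $ i \<le> r \<and> \<beta> * (r - a $ i) - \<alpha> * (\<Sum>j\<in>{i<..}. max 0 (r - a $ j))
            - \<alpha> * (\<Sum>j\<in>{..<i}. max 0 (f j - a $ i)) = 1"
  have "\<exists>f. \<forall>i. ?P f i (f i)"
  \<comment> \<open>Equation i mentions the values of f only below i, so the unknowns can be chosen
    one after another.\<close>
  proof (rule dependent_wf_choice[OF wf_less_finite])
    fix f g :: "'n \<Rightarrow> real" and i r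
    assume "\<And>j. (j, i) \<in> {(i, j). i < j} \<Longrightarrow> f j = g j"
    then have "(\<Sum>j\<in>{..<i}. max 0 (f j - a $ i)) = (\<Sum>j\<in>{..<i}. max 0 (g j - a $ i))"
      by (intro sum.cong) auto
    then show "?P f i r = ?P g i r" by simp
  next
    fix i and f :: "'n \<Rightarrow> real"
    define c where "c = 1 + \<alpha> * (\<Sum>j\<in>{..<i}. max 0 (f j - a $ i))"
    define \<rho> where "\<rho> = \<beta> - \<alpha> * (real CARD('n) - 1)"
    define G where "G = (\<lambda>x. \<beta> * x - \<alpha> * (\<Sum>j\<in>{i<..}. max 0 (x - a $ j)))"
    have "c \<ge> 1" using assms(1) by (simp add: c_def sum_nonneg)
    have "\<rho> > 0" using assms(2) by (simp add: \<rho>_def)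
    \<comment> \<open>At x = a_i no later index has arrived strictly earlier, so G starts at beta
      a_i, below the target beta a_i + c.\<close>
    have "(\<Sum>j\<in>{i<..}. max 0 (a $ i - a $ j)) = 0"
      using assms(3) by (intro sum.neutral) (auto simp: sorted_vecD max_absorb1)
    then have G0: "G (a $ i) = \<beta> * a $ i" by (simp add: G_def)
    \<comment> \<open>G rises at rate at least \<open>\<rho>\<close>, so over a length c /
      \<open>\<rho>\<close> it gains at least c: this is the right end of the interval for the
      intermediate value theorem.\<close>
    have "\<rho> * ((a $ i + c / \<rho>) - a $ i) \<le> G (a $ i + c / \<rho>) - G (a $ i)"
      unfolding \<rho>_def G_def
      by (rule sum_pos_part_increment[of \<alpha> i])
         (use assms(1) \<open>c \<ge> 1\<close> \<open>\<rho> > 0\<close> in \<open>auto simp flip: \<rho>_def\<close>)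
    then have "G (a $ i) \<le> \<beta> * a $ i + c" "\<beta> * a $ i + c \<le> G (a $ i + c / \<rho>)"
      using G0 \<open>\<rho> > 0\<close> \<open>c \<ge> 1\<close> by auto
    moreover have "a $ i \<le> a $ i + c / \<rho>" using \<open>\<rho> > 0\<close> \<open>c \<ge> 1\<close> by simp
    moreover have "continuous_on {a $ i..a $ i + c / \<rho>} G"
      unfolding G_def by (intro continuous_intros)
    ultimately obtain x where "a $ i \<le> x" "G x = \<beta> * a $ i + c"
      using IVT'[of G "a $ i" "\<beta> * a $ i + c" "a $ i + c / \<rho>"] by blast
    then show "\<exists>r. ?P f i r"
      by (intro exI[of _ x]) (simp add: G_def c_def algebra_simps)
  qed
  then obtain f where "\<forall>i. ?P f i (f i)" ..
  then show ?thesis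
    by (intro exI[of _ "\<chi> i. f i"]) (simp add: fifo_system_def)
qed

text \<open>Once the earlier components agree, d_i and e_i solve the same scalar equation, whose
  left side is strictly increasing.\<close>

lemma fifo_system_unique:
  fixes a d e :: "real^'n::{finite,linorder}"
  assumes "\<alpha> > 0" "\<alpha> * (real CARD('n) - 1) < \<beta>" "fifo_system \<alpha> \<beta> a d" "fifo_system \<alpha> \<beta> a e"
  shows "d = e"
proof -
  define \<rho> where "\<rho> = \<beta> - \<alpha> * (real CARD('n) - 1)"
  have "\<rho> > 0" using assms(2) by (simp add: \<rho>_def)
  have "d $ i = e $ i" for i
  proof (induction i rule: finite_less_induct)
    case (less i)
    define G where "G = (\<lambda>x. \<beta> * x - \<alpha> * (\<Sum>j\<in>{i<..}. max 0 (x - a $ j)))"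
    have "(\<Sum>j\<in>{..<i}. max 0 (d $ j - a $ i)) = (\<Sum>j\<in>{..<i}. max 0 (e $ j - a $ i))"
      using less by (intro sum.cong) auto
    then have "\<alpha> * (\<Sum>j\<in>{..<i}. max 0 (d $ j - a $ i)) = \<alpha> * (\<Sum>j\<in>{..<i}. max 0 (e $ j - a $ i))"
      by (rule arg_cong)
    then have eq: "G (d $ i) = G (e $ i)"
      using assms(3,4)[unfolded fifo_system_def, rule_format, of i]
      unfolding G_def right_diff_distrib by linarith
    have *: "y \<le> x" if "G x = G y" for x y
    proof (rule ccontr)
      assume "\<not> y \<le> x"
      then have "\<rho> * (y - x) \<le> G y - G x"
        unfolding \<rho>_def G_def by (intro sum_pos_part_increment[of \<alpha> i]) (use assms(1) in auto)
      moreover have "\<rho> * (y - x) > 0" using \<open>\<rho> > 0\<close> \<open>\<not> y \<le> x\<close> by simp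
      ultimately show False using that by simp
    qed
    show ?case using *[OF eq] *[OF eq[symmetric]] by simp
  qed
  then show ?thesis by (simp add: vec_eq_iff)
qed

lemma fifo_system_sorted:
  fixes a d :: "real^'n::{finite,linorder}"
  assumes "\<alpha> > 0" "\<alpha> * (real CARD('n) - 1) < \<beta>" "sorted_vec a" "fifo_system \<alpha> \<beta> a d"
  shows "sorted_vec d"
proof -
  define \<rho> where "\<rho> = \<beta> - \<alpha> * (real CARD('n) - 1)"
  have "\<rho> > 0" using assms(2) by (simp add: \<rho>_def)
  \<comment> \<open>If d l < d i, then comparing the i-th and l-th equations bounds the increment of G from above by
    a nonpositive number, although G is strictly increasing.\<close>
  have "i \<le> l \<longrightarrow> d $ i \<le> d $ l" for i l
  proof (induction l rule: finite_less_induct)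
    case (less l)
    show ?case
    proof (cases "i < l")
      case True
      show ?thesis
      proof (rule impI, rule ccontr)
        assume "\<not> d $ i \<le> d $ l"
        then have dl: "d $ l < d $ i" by simp
        have al: "a $ i \<le> a $ l" using assms(3) True by (simp add: sorted_vecD)
        define G where "G = (\<lambda>x. \<beta> * x - \<alpha> * (\<Sum>j\<in>{l<..}. max 0 (x - a $ j)))"
        have gap: "\<rho> * (d $ i - d $ l) \<le> G (d $ i) - G (d $ l)"
          unfolding \<rho>_def G_def by (rule sum_pos_part_increment[of \<alpha> l]) (use assms(1) dl in auto)
        define s where "s = a $ l - a $ i"
        have "s \<ge> 0" using al by (simp add: s_def)
        \<comment> \<open>Isolating l here and i in the next split exposes the mutual term
          \<open>max 0 (d $ i - a $ l)\<close>; it is common to both equations and cancels.\<close>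
        have 1: "(\<Sum>j\<in>{i<..}. max 0 (d $ i - a $ j)) =
            (\<Sum>j\<in>{i<..<l}. max 0 (d $ i - a $ j)) + max 0 (d $ i - a $ l) +
            (\<Sum>j\<in>{l<..}. max 0 (d $ i - a $ j))"
        proof -
          have "{i<..} = {i<..<l} \<union> insert l {l<..}" using True by auto
          moreover have "(\<Sum>j\<in>{i<..<l} \<union> insert l {l<..}. max 0 (d $ i - a $ j)) =
              (\<Sum>j\<in>{i<..<l}. max 0 (d $ i - a $ j)) + (\<Sum>j\<in>insert l {l<..}. max 0 (d $ i - a $ j))"
            by (rule sum.union_disjoint) auto
          ultimately show ?thesis by simp
        qed
        have 2: "(\<Sum>j\<in>{..<l}. max 0 (d $ j - a $ l)) =
            (\<Sum>j\<in>{..<i}. max 0 (d $ j - a $ l)) + max 0 (d $ i - a $ l) +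
            (\<Sum>j\<in>{i<..<l}. max 0 (d $ j - a $ l))"
        proof -
          have "{..<l} = {..<i} \<union> insert i {i<..<l}" using True by auto
          moreover have "(\<Sum>j\<in>{..<i} \<union> insert i {i<..<l}. max 0 (d $ j - a $ l)) =
              (\<Sum>j\<in>{..<i}. max 0 (d $ j - a $ l)) + (\<Sum>j\<in>insert i {i<..<l}. max 0 (d $ j - a $ l))"
            by (rule sum.union_disjoint) auto
          ultimately show ?thesis by simp
        qed
        have "(\<Sum>j\<in>{..<i}. max 0 (d $ j - a $ i) - max 0 (d $ j - a $ l)) \<le> (\<Sum>j\<in>{..<i}. s)"
          using al by (intro sum_mono) (auto simp: max_def s_def)
        moreover have "(\<Sum>j\<in>{i<..<l}. max 0 (d $ i - a $ j) - max 0 (d $ j - a $ l)) \<le> (\<Sum>j\<in>{i<..<l}. s)"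
        proof (rule sum_mono)
          fix j assume j: "j \<in> {i<..<l}"
          \<comment> \<open>The induction on l is needed for d_i <= d_j here: it bounds the
            difference by a_l - a_j, hence by s.\<close>
          then have "a $ i \<le> a $ j" "a $ j \<le> a $ l" "d $ i \<le> d $ j"
            using less assms(3) by (auto simp: sorted_vecD)
          then show "max 0 (d $ i - a $ j) - max 0 (d $ j - a $ l) \<le> s"
            using al by (auto simp: s_def max_def)
        qed
        moreover have "(\<Sum>j\<in>{..<i}. s) + (\<Sum>j\<in>{i<..<l}. s) \<le> (real CARD('n) - 1) * s"
        proof -
          have "(\<Sum>j\<in>{..<i}. s) + (\<Sum>j\<in>{i<..<l}. s) = (\<Sum>j\<in>{..<i} \<union> {i<..<l}. s)"
            by (rule sum.union_disjoint[symmetric]) auto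
          also have "\<dots> = real (card ({..<i} \<union> {i<..<l})) * s" by simp
          also have "\<dots> \<le> (real CARD('n) - 1) * s"
            by (intro mult_right_mono card_le_CARD_minus_1[of i] \<open>s \<ge> 0\<close>) auto
          finally show ?thesis .
        qed
        ultimately have "(\<Sum>j\<in>{..<i}. max 0 (d $ j - a $ i) - max 0 (d $ j - a $ l)) +
            (\<Sum>j\<in>{i<..<l}. max 0 (d $ i - a $ j) - max 0 (d $ j - a $ l)) \<le> (real CARD('n) - 1) * s"
          by linarith
        then have "\<alpha> * ((\<Sum>j\<in>{..<i}. max 0 (d $ j - a $ i) - max 0 (d $ j - a $ l)) +
            (\<Sum>j\<in>{i<..<l}. max 0 (d $ i - a $ j) - max 0 (d $ j - a $ l))) \<le> \<alpha> * ((real CARD('n) - 1) * s)"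
          using assms(1) by (intro mult_left_mono) auto
        \<comment> \<open>Subtracting the equations leaves - beta s plus alpha times the two
          difference sums, which are at most (N - 1) s together.\<close>
        then have "G (d $ i) - G (d $ l) \<le> - (\<rho> * s)"
          using assms(4)[unfolded fifo_system_def, rule_format, of i]
                assms(4)[unfolded fifo_system_def, rule_format, of l]
          unfolding 1 2 G_def \<rho>_def s_def sum_subtractf right_diff_distrib left_diff_distrib distrib_left
          by linarith
        moreover have "\<rho> * s \<ge> 0" "\<rho> * (d $ i - d $ l) > 0"
          using \<open>\<rho> > 0\<close> \<open>s \<ge> 0\<close> dl by auto
        ultimately show False using gap by linarith
      qed
    next
      case False
      then show ?thesis by auto
    qed
  qed
  then show ?thesis by (simp add: sorted_vec_def)
qed

text \<open>For sorted d both sides are the same equations; an unsorted d satisfies neither side, by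
  the two sortedness lemmas.\<close>

lemma is_departure_vector_iff_fifo_system:
  fixes a d :: "real^'n::{finite,linorder}"
  assumes "\<alpha> > 0" "\<alpha> * (real CARD('n) - 1) < \<beta>" "sorted_vec a"
  shows "is_departure_vector \<alpha> \<beta> a d \<longleftrightarrow> (\<forall>i. a $ i \<le> d $ i) \<and> fifo_system \<alpha> \<beta> a d"
proof -
  have *: ?thesis if "sorted_vec d"
  proof (cases "\<forall>i. a $ i \<le> d $ i")
    case True
    then have ad: "a $ i \<le> d $ i" for i by simp
    have "(\<beta> + \<alpha>) * (d $ i - a $ i) - \<alpha> * (\<Sum>j\<in>UNIV. overlap a d i j) =
        \<beta> * (d $ i - a $ i) - \<alpha> * (\<Sum>j\<in>{i<..}. max 0 (d $ i - a $ j))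
          - \<alpha> * (\<Sum>j\<in>{..<i}. max 0 (d $ j - a $ i))" for i
      unfolding sum_overlap[OF assms(3) that ad] distrib_left distrib_right by linarith
    with True show ?thesis
      unfolding is_departure_vector_iff_overlap fifo_system_def by simp
  qed (auto simp: is_departure_vector_def)
  show ?thesis
    using * is_departure_vector_sorted[OF assms] fifo_system_sorted[OF assms] by blast
qed

lemma departure_iff:
  fixes a d :: "real^'n::{finite,linorder}"
  assumes "\<alpha> > 0" "\<alpha> * (real CARD('n) - 1) < \<beta>" "sorted_vec a"
  shows "departure \<alpha> \<beta> a = d \<longleftrightarrow> (\<forall>i. a $ i \<le> d $ i) \<and> fifo_system \<alpha> \<beta> a d"
proof -
  have "\<exists>!d. (\<forall>i. a $ i \<le> d $ i) \<and> fifo_system \<alpha> \<beta> a d"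
    using ex_fifo_system[OF assms] fifo_system_unique[OF assms(1,2)] by blast
  from the1_equality[OF this] theI'[OF this] show ?thesis
    unfolding departure_def is_departure_vector_iff_fifo_system[OF assms]
    by blast
qed

section \<open>The matrices A and D as a count of active positive parts\<close>

text \<open>Rank differences become numbers of summands. The first form serves the diagonal of D,
  the second that of A.\<close>

lemma index_diff_eq_card:
  fixes p q :: "'n::{finite,linorder}"
  assumes "p \<le> q"
  shows "index_diff q p = real (card {p<..q})" "index_diff q p = real (card {p..<q})"
proof -
  have "card ({..p} \<union> {p<..q}) = card {..p} + card {p<..q}"
    by (rule card_Un_disjoint) auto
  moreover have "{..p} \<union> {p<..q} = {..q}" using assms by auto
  ultimately show 1: "index_diff q p = real (card {p<..q})"
    by (simp add: index_diff_def index_rank_def atMost_def)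
  have "insert q {p..<q} = insert p {p<..q}" using assms by auto
  then have "card (insert q {p..<q}) = card (insert p {p<..q})" by simp
  then have "card {p..<q} = card {p<..q}" by simp
  with 1 show "index_diff q p = real (card {p..<q})" by simp
qed

lemma K_setD:
  assumes "k \<in> K_set"
  shows "k last_index = last_index" "i \<le> j \<Longrightarrow> k i \<le> k j" "i \<le> k i"
  using assms unfolding K_set_def by blast+

text \<open>\<open>h_index k\<close> is the lower adjoint of the monotone map \<open>k\<close>. This
  translates the bands of the matrices into the relation i <= k_j, meaning that j is still present
  when i arrives.\<close>

lemma h_index_le_iff:
  assumes "k \<in> K_set"
  shows "h_index k i \<le> j \<longleftrightarrow> i \<le> k j"
proof -
  have "{h. i \<le> k h} \<noteq> {}" using K_setD(3)[OF assms] by blast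
  then have "h_index k i \<le> j \<longleftrightarrow> (\<exists>h\<in>{h. i \<le> k h}. h \<le> j)"
    unfolding h_index_def by (intro Min_le_iff) (rule finite)
  also have "\<dots> \<longleftrightarrow> i \<le> k j"
  proof
    assume "\<exists>h\<in>{h. i \<le> k h}. h \<le> j"
    then obtain h where "i \<le> k h" "h \<le> j" by auto
    with K_setD(2)[OF assms this(2)] show "i \<le> k j" by (blast intro: order.trans)
  next
    assume "i \<le> k j" then show "\<exists>h\<in>{h. i \<le> k h}. h \<le> j" by blast
  qed
  finally show ?thesis .
qed

lemma atLeastLessThan_h_index:
  assumes "k \<in> K_set"
  shows "{h_index k i..<i} = {j. j < i \<and> i \<le> k j}"
  by (rule set_eqI) (simp add: h_index_le_iff[OF assms] conj_commute)

lemma sum_row_diag: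
  fixes x :: "real^'n"
  assumes "i \<notin> S"
  shows "(\<Sum>j\<in>UNIV. (if i = j then c else if j \<in> S then - \<alpha> else 0) * x $ j) =
           c * x $ i - \<alpha> * (\<Sum>j\<in>S. x $ j)"
proof -
  have "(\<Sum>j\<in>UNIV. (if i = j then c else if j \<in> S then - \<alpha> else 0) * x $ j) =
      (\<Sum>j\<in>UNIV. (if i = j then c * x $ j else 0) - \<alpha> * (if j \<in> S then x $ j else 0))"
    using assms by (intro sum.cong) auto
  also have "\<dots> = c * x $ i - \<alpha> * (\<Sum>j\<in>UNIV. if j \<in> S then x $ j else 0)"
    by (simp add: sum_subtractf sum_distrib_left[symmetric])
  also have "(\<Sum>j\<in>UNIV. if j \<in> S then x $ j else 0) = (\<Sum>j\<in>S. x $ j)"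
    by (simp add: sum.inter_restrict[symmetric])
  finally show ?thesis .
qed

lemma le_last_index: "i \<le> last_index"
  by (simp add: last_index_def)

lemma D_mat_mult:
  assumes "k \<in> K_set"
  shows "(D_mat \<alpha> \<beta> k *v d) $ i =
    (\<beta> - \<alpha> * real (card {i<..k i})) * d $ i - \<alpha> * (\<Sum>j\<in>{j. j < i \<and> i \<le> k j}. d $ j)"
  unfolding atLeastLessThan_h_index[OF assms, symmetric] index_diff_eq_card(1)[OF K_setD(3)[OF assms], symmetric]
  by (subst sum_row_diag[symmetric]) (auto simp: matrix_vector_mult_def D_mat_def intro!: sum.cong)

lemma A_mat_mult:
  assumes "k \<in> K_set"
  shows "(A_mat \<alpha> \<beta> k *v a) $ i =
    (\<beta> - \<alpha> * real (card {j. j < i \<and> i \<le> k j})) * a $ i - \<alpha> * (\<Sum>j\<in>{i<..k i}. a $ j)"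
proof -
  have "h_index k i \<le> i" using K_setD(3)[OF assms] by (simp add: h_index_le_iff[OF assms])
  note card_eq = index_diff_eq_card(2)[OF this]
  show ?thesis
    unfolding atLeastLessThan_h_index[OF assms, symmetric] card_eq[symmetric]
    by (subst sum_row_diag[symmetric]) (auto simp: matrix_vector_mult_def A_mat_def intro!: sum.cong)
qed

lemma D_mat_diag_pos:
  fixes k :: "'n::{finite,linorder} \<Rightarrow> 'n"
  assumes "\<alpha> > 0" "\<alpha> * (real CARD('n) - 1) < \<beta>"
  shows "\<beta> - \<alpha> * real (card {i<..k i}) > 0"
proof -
  have "\<alpha> * real (card {i<..k i}) \<le> \<alpha> * (real CARD('n) - 1)"
    using assms(1) by (intro mult_left_mono card_le_CARD_minus_1[of i]) auto
  with assms(2) show ?thesis by simp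
qed

text \<open>Forward substitution: row i involves only indices up to i, with a positive diagonal
  entry.\<close>

lemma D_mat_mult_eq_0:
  fixes k :: "'n::{finite,linorder} \<Rightarrow> 'n"
  assumes "\<alpha> > 0" "\<alpha> * (real CARD('n) - 1) < \<beta>" "k \<in> K_set" "D_mat \<alpha> \<beta> k *v x = 0"
  shows "x = 0"
proof -
  have "x $ i = 0" for i
  proof (induction i rule: finite_less_induct)
    case (less i)
    have "(\<Sum>j\<in>{j. j < i \<and> i \<le> k j}. x $ j) = 0" using less by simp
    then have "(\<beta> - \<alpha> * real (card {i<..k i})) * x $ i = 0"
      using D_mat_mult[OF assms(3), of \<alpha> \<beta> x i] assms(4) by simp
    then show ?case using D_mat_diag_pos[OF assms(1,2), of i k] by simp
  qed
  then show ?thesis by (simp add: vec_eq_iff)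
qed

lemma invertible_D_mat:
  fixes k :: "'n::{finite,linorder} \<Rightarrow> 'n"
  assumes "\<alpha> > 0" "\<alpha> * (real CARD('n) - 1) < \<beta>" "k \<in> K_set"
  shows "invertible (D_mat \<alpha> \<beta> k)"
  unfolding invertible_left_inverse matrix_left_invertible_ker
  using D_mat_mult_eq_0[OF assms] by blast

text \<open>Removes the inverse, so that later arguments work with the explicit rows of D and
  A.\<close>

lemma Theta_eta_eq_iff:
  fixes k :: "'n::{finite,linorder} \<Rightarrow> 'n"
  assumes "\<alpha> > 0" "\<alpha> * (real CARD('n) - 1) < \<beta>" "k \<in> K_set"
  shows "Theta \<alpha> \<beta> k *v a + eta \<alpha> \<beta> k = d \<longleftrightarrow> D_mat \<alpha> \<beta> k *v d = A_mat \<alpha> \<beta> k *v a + vec 1"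
proof -
  let ?D = "D_mat \<alpha> \<beta> k"
  have inv: "?D ** matrix_inv ?D = mat 1" "matrix_inv ?D ** ?D = mat 1"
    using someI_ex[OF invertible_D_mat[OF assms, unfolded invertible_def]]
    by (simp_all add: matrix_inv_def)
  have "Theta \<alpha> \<beta> k *v a + eta \<alpha> \<beta> k = matrix_inv ?D *v (A_mat \<alpha> \<beta> k *v a + vec 1)"
    by (simp add: Theta_def eta_def matrix_vector_right_distrib matrix_vector_mul_assoc)
  then show ?thesis
    by (metis inv matrix_vector_mul_assoc matrix_vector_mul_lid)
qed

text \<open>Setting a = 0 shows D eta = 1. The off-diagonal entries of D are nonpositive, so forward
  substitution keeps every component positive.\<close>

lemma eta_pos:
  fixes k :: "'n::{finite,linorder} \<Rightarrow> 'n"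
  assumes "\<alpha> > 0" "\<alpha> * (real CARD('n) - 1) < \<beta>" "k \<in> K_set"
  shows "eta \<alpha> \<beta> k $ i > 0"
proof (induction i rule: finite_less_induct)
  case (less i)
  have "D_mat \<alpha> \<beta> k *v eta \<alpha> \<beta> k = vec 1"
    using Theta_eta_eq_iff[OF assms, of 0 "eta \<alpha> \<beta> k"] by simp
  then have "(\<beta> - \<alpha> * real (card {i<..k i})) * eta \<alpha> \<beta> k $ i =
      1 + \<alpha> * (\<Sum>j\<in>{j. j < i \<and> i \<le> k j}. eta \<alpha> \<beta> k $ j)"
    using D_mat_mult[OF assms(3), of \<alpha> \<beta> "eta \<alpha> \<beta> k" i] by simp
  moreover have "(\<Sum>j\<in>{j. j < i \<and> i \<le> k j}. eta \<alpha> \<beta> k $ j) \<ge> 0"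
    using less by (intro sum_nonneg) (simp add: less_imp_le)
  ultimately have "(\<beta> - \<alpha> * real (card {i<..k i})) * eta \<alpha> \<beta> k $ i > 0"
    using assms(1) by (simp add: add_pos_nonneg)
  then show ?case
    using D_mat_diag_pos[OF assms(1,2), of i k] by (simp add: zero_less_mult_iff)
qed

section \<open>Pieces and the departure vector on them\<close>

text \<open>Comparing x with all entries instead of two neighbours removes the successor index and
  the infinite entry a_(N+1) from later arguments.\<close>

lemma between_consecutive_entries_iff:
  assumes "sorted_vec a"
  shows "a $ m \<le> x \<and> ereal x \<le> next_entry a m \<longleftrightarrow>
         (\<forall>j\<le>m. a $ j \<le> x) \<and> (\<forall>j>m. x \<le> a $ j)"
proof -
  have "a $ m \<le> x \<longleftrightarrow> (\<forall>j\<le>m. a $ j \<le> x)"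
    by (meson order_refl order_trans sorted_vecD[OF assms])
  moreover have "ereal x \<le> next_entry a m \<longleftrightarrow> (\<forall>j>m. x \<le> a $ j)"
  proof (cases "m = last_index")
    case True
    then have "\<not> m < j" for j using le_last_index[of j] by simp
    with True show ?thesis by (simp add: next_entry_def)
  next
    case False
    then have "m < last_index" using le_last_index[of m] by simp
    then have *: "Min {j. m < j} \<in> {j. m < j}" by (intro Min_in) auto
    have "a $ Min {j. m < j} \<le> a $ j" if "m < j" for j
      using that by (intro sorted_vecD[OF assms] Min_le) auto
    then have "x \<le> a $ Min {j. m < j} \<longleftrightarrow> (\<forall>j>m. x \<le> a $ j)"
      by (meson mem_Collect_eq order_trans *)
    with False show ?thesis by (simp add: next_entry_def)
  qed
  ultimately show ?thesis by simp
qed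

text \<open>For j > i the term d_i - a_j survives when j <= k_i, and for j < i the term d_j - a_i
  survives when i <= k_j. The number of the former enters the diagonal of D, that of the latter the
  diagonal of A.\<close>

lemma fifo_system_iff_linear:
  fixes a d :: "real^'n::{finite,linorder}"
  assumes "k \<in> K_set"
    and le: "\<And>i j. j \<le> k i \<Longrightarrow> a $ j \<le> d $ i" and ge: "\<And>i j. k i < j \<Longrightarrow> d $ i \<le> a $ j"
  shows "fifo_system \<alpha> \<beta> a d \<longleftrightarrow> D_mat \<alpha> \<beta> k *v d = A_mat \<alpha> \<beta> k *v a + vec 1"
proof -
  have "\<beta> * (d $ i - a $ i) - \<alpha> * (\<Sum>j\<in>{i<..}. max 0 (d $ i - a $ j))
            - \<alpha> * (\<Sum>j\<in>{..<i}. max 0 (d $ j - a $ i)) =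
        (D_mat \<alpha> \<beta> k *v d) $ i - (A_mat \<alpha> \<beta> k *v a) $ i" for i
  proof -
    have "(\<Sum>j\<in>{i<..}. max 0 (d $ i - a $ j)) = (\<Sum>j\<in>{i<..k i}. d $ i - a $ j)"
      using le ge by (intro sum.mono_neutral_cong_right) (auto simp: max_absorb1 max_absorb2 not_le)
    also have "\<dots> = real (card {i<..k i}) * d $ i - (\<Sum>j\<in>{i<..k i}. a $ j)"
      by (simp add: sum_subtractf)
    finally have 1: "(\<Sum>j\<in>{i<..}. max 0 (d $ i - a $ j)) = \<dots>" .
    have "(\<Sum>j\<in>{..<i}. max 0 (d $ j - a $ i)) = (\<Sum>j\<in>{j. j < i \<and> i \<le> k j}. d $ j - a $ i)"
      using le ge by (intro sum.mono_neutral_cong_right) (auto simp: max_absorb1 max_absorb2 not_le)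
    also have "\<dots> = (\<Sum>j\<in>{j. j < i \<and> i \<le> k j}. d $ j) - real (card {j. j < i \<and> i \<le> k j}) * a $ i"
      by (simp add: sum_subtractf)
    finally have 2: "(\<Sum>j\<in>{..<i}. max 0 (d $ j - a $ i)) = \<dots>" .
    show ?thesis
      unfolding 1 2 D_mat_mult[OF assms(1)] A_mat_mult[OF assms(1)] right_diff_distrib left_diff_distrib
      by (simp add: mult.assoc)
  qed
  then show ?thesis
    unfolding fifo_system_def vec_eq_iff by (simp add: diff_eq_eq add.commute)
qed

lemma search_region_sorted: "a \<in> search_region \<alpha> \<beta> dstar \<Longrightarrow> sorted_vec a"
  by (simp add: search_region_def sorted_vec_def Let_def)

lemma piece_iff:
  assumes "a \<in> search_region \<alpha> \<beta> dstar"
  shows "a \<in> piece \<alpha> \<beta> dstar k \<longleftrightarrow>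
    (\<forall>i. (\<forall>j\<le>k i. a $ j \<le> (Theta \<alpha> \<beta> k *v a + eta \<alpha> \<beta> k) $ i) \<and>
         (\<forall>j>k i. (Theta \<alpha> \<beta> k *v a + eta \<alpha> \<beta> k) $ i \<le> a $ j))"
  using assms between_consecutive_entries_iff[OF search_region_sorted[OF assms]]
  by (simp add: piece_def)

text \<open>The inequalities of the piece speak about the candidate itself and certify that it
  solves the system; i <= k_i gives a_i <= d_i.\<close>

lemma departure_piece:
  fixes dstar :: "real^'n::{finite,linorder}"
  assumes "\<alpha> > 0" "\<alpha> * (real CARD('n) - 1) < \<beta>" "k \<in> K_set" "a \<in> piece \<alpha> \<beta> dstar k"
  shows "departure \<alpha> \<beta> a = Theta \<alpha> \<beta> k *v a + eta \<alpha> \<beta> k"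
proof -
  define d where "d = Theta \<alpha> \<beta> k *v a + eta \<alpha> \<beta> k"
  have R: "a \<in> search_region \<alpha> \<beta> dstar" using assms(4) by (simp add: piece_def)
  have cell: "j \<le> k i \<Longrightarrow> a $ j \<le> d $ i" "k i < j \<Longrightarrow> d $ i \<le> a $ j" for i j
    using assms(4) unfolding piece_iff[OF R] d_def by blast+
  have "D_mat \<alpha> \<beta> k *v d = A_mat \<alpha> \<beta> k *v a + vec 1"
    using Theta_eta_eq_iff[OF assms(1-3), of a d] by (simp add: d_def)
  then have "fifo_system \<alpha> \<beta> a d"
    using fifo_system_iff_linear[OF assms(3) cell] by simp
  moreover have "a $ i \<le> d $ i" for i
    using cell(1) K_setD(3)[OF assms(3)] by blast
  ultimately show ?thesis
    unfolding departure_iff[OF assms(1,2) search_region_sorted[OF R]] d_def[symmetric] by blast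
qed

lemma search_region_subset_pieces:
  fixes dstar :: "real^'n::{finite,linorder}"
  assumes "\<alpha> > 0" "\<alpha> * (real CARD('n) - 1) < \<beta>" "a \<in> search_region \<alpha> \<beta> dstar"
  shows "\<exists>k\<in>K_set. a \<in> piece \<alpha> \<beta> dstar k"
proof -
  have a: "sorted_vec a" using assms(3) by (rule search_region_sorted)
  obtain d where ad: "\<And>i. a $ i \<le> d $ i" and F: "fifo_system \<alpha> \<beta> a d"
    using ex_fifo_system[OF assms(1,2) a] by blast
  have d: "sorted_vec d" using fifo_system_sorted[OF assms(1,2) a F] .
  \<comment> \<open>The set contains i, hence i <= k_i, and sortedness of d makes \<open>k\<close>
    monotone. Where several choices are admissible because of ties, the largest is taken.\<close>
  define k where "k = (\<lambda>i. Max {j. a $ j \<le> d $ i})"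
  have in_k: "k i \<in> {j. a $ j \<le> d $ i}" for i
    unfolding k_def using ad by (intro Max_in) auto
  have le_k: "j \<le> k i" if "a $ j \<le> d $ i" for i j
    unfolding k_def using that by (intro Max_ge) auto
  have ik: "i \<le> k i" for i by (rule le_k) (rule ad)
  have "k last_index = last_index"
    using ik[of last_index] le_last_index by (rule order.antisym[rotated])
  moreover have "k i \<le> k j" if "i \<le> j" for i j
    using in_k[of i] sorted_vecD[OF d that] by (intro le_k) simp
  ultimately have k: "k \<in> K_set" using ik by (simp add: K_set_def)
  have cell: "a $ j \<le> d $ i" if "j \<le> k i" for i j
    using in_k[of i] sorted_vecD[OF a that] by simp
  have cell': "d $ i \<le> a $ j" if "k i < j" for i j
    using le_k[of j i] that by (meson linear not_le)
  have "Theta \<alpha> \<beta> k *v a + eta \<alpha> \<beta> k = d"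
    using F fifo_system_iff_linear[OF k cell cell'] Theta_eta_eq_iff[OF assms(1,2) k] by simp
  then have "a \<in> piece \<alpha> \<beta> dstar k"
    unfolding piece_iff[OF assms(3)] using cell cell' by simp
  with k show ?thesis by blast
qed

section \<open>The pieces are polytopes\<close>

lemma polyhedron_linear_le:
  fixes f :: "'a::euclidean_space \<Rightarrow> real"
  assumes "linear f"
  shows "polyhedron {x. f x \<le> c}"
proof -
  \<comment> \<open>The normal vector of the half-space is the vector that represents f through the
    inner product.\<close>
  have "f x = adjoint f 1 \<bullet> x" for x
    using adjoint_works[OF assms, of x 1] by (simp add: inner_commute)
  then show ?thesis by (simp add: polyhedron_halfspace_le)
qed

lemma linear_nth: "linear (\<lambda>x :: real^'n. x $ i)"
  by (rule linearI) auto

lemma linear_matrix_nth: "linear (\<lambda>x. (M *v x) $ i)" for M :: "real^'n^'m"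
  by (rule linearI) (auto simp: matrix_vector_right_distrib matrix_vector_mult_scaleR)

lemma polyhedron_nth_le: "polyhedron {x :: real^'n. x $ i \<le> c}"
  by (rule polyhedron_linear_le) (rule linear_nth)

lemma polyhedron_nth_ge: "polyhedron {x :: real^'n. c \<le> x $ i}"
  using polyhedron_linear_le[OF linear_compose_neg[OF linear_nth[of i]], of "- c"] by simp

lemma polyhedron_nth_le_nth: "polyhedron {x :: real^'n. x $ i \<le> x $ j}"
  using polyhedron_linear_le[OF linear_compose_sub[OF linear_nth[of i] linear_nth[of j]], of 0] by simp

lemma polyhedron_nth_le_affine: "polyhedron {x. x $ j \<le> (M *v x + v) $ i}" for M :: "real^'n^'n"
  using polyhedron_linear_le[OF linear_compose_sub[OF linear_nth[of j] linear_matrix_nth[of M i]], of "v $ i"]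
  by (simp add: diff_le_eq add.commute)

lemma polyhedron_affine_le_nth: "polyhedron {x. (M *v x + v) $ i \<le> x $ j}" for M :: "real^'n^'n"
  using polyhedron_linear_le[OF linear_compose_sub[OF linear_matrix_nth[of M i] linear_nth[of j]], of "- (v $ i)"]
  by (simp add: algebra_simps)

lemma polyhedron_INT_finite:
  fixes F :: "'n::finite \<Rightarrow> 'a::euclidean_space set"
  assumes "\<And>i. polyhedron (F i)"
  shows "polyhedron (\<Inter>i. F i)"
  using assms by (intro polyhedron_Inter) auto

lemma polyhedron_search_region: "polyhedron (search_region \<alpha> \<beta> dstar)"
  for dstar :: "real^'n::{finite,linorder}"
proof -
  define N where "N = real CARD('n)"
  define l where "l = dstar $ first_index - N / (\<beta> - \<alpha> * (N - 1))"
  define u where "u = dstar $ last_index + N / (\<beta> - \<alpha> * (N - 1))"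
  have "search_region \<alpha> \<beta> dstar =
      {a. l \<le> a $ first_index} \<inter> (\<Inter>i. \<Inter>j. {a. i \<le> j \<longrightarrow> a $ i \<le> a $ j}) \<inter>
      {a. a $ last_index \<le> u}"
    unfolding search_region_def Let_def N_def[symmetric] l_def[symmetric] u_def[symmetric]
    by blast
  also have "polyhedron \<dots>"
  proof (intro polyhedron_Int polyhedron_INT_finite polyhedron_nth_le polyhedron_nth_ge)
    fix i j :: 'n
    show "polyhedron {a :: real^_. i \<le> j \<longrightarrow> a $ i \<le> a $ j}"
      by (cases "i \<le> j") (simp_all add: polyhedron_nth_le_nth)
  qed
  finally show ?thesis .
qed

lemma bounded_search_region: "bounded (search_region \<alpha> \<beta> dstar)"
  for dstar :: "real^'n::{finite,linorder}"
proof -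
  define N where "N = real CARD('n)"
  define l where "l = dstar $ first_index - N / (\<beta> - \<alpha> * (N - 1))"
  define u where "u = dstar $ last_index + N / (\<beta> - \<alpha> * (N - 1))"
  have "search_region \<alpha> \<beta> dstar \<subseteq> cbox (\<chi> i. l) (\<chi> i. u)"
  proof
    fix a assume a: "a \<in> search_region \<alpha> \<beta> dstar"
    then have bds: "l \<le> a $ first_index" "a $ last_index \<le> u"
      unfolding search_region_def Let_def l_def u_def N_def by simp_all
    have "l \<le> a $ i \<and> a $ i \<le> u" for i
    proof -
      have "first_index \<le> i" by (simp add: first_index_def)
      then have "a $ first_index \<le> a $ i" "a $ i \<le> a $ last_index"
        using sorted_vecD[OF search_region_sorted[OF a]] le_last_index by blast+
      with bds show ?thesis by linarith
    qed
    then show "a \<in> cbox (\<chi> i. l) (\<chi> i. u)" by (simp add: mem_box_cart)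
  qed
  then show ?thesis by (rule bounded_subset[OF bounded_cbox])
qed

lemma polytope_piece: "polytope (piece \<alpha> \<beta> dstar k)"
  for dstar :: "real^'n::{finite,linorder}"
proof -
  let ?d = "\<lambda>a i. (Theta \<alpha> \<beta> k *v a + eta \<alpha> \<beta> k) $ i"
  \<comment> \<open>The extended-real bound becomes an ordinary half-space, or the whole space when
    k_i is the last index.\<close>
  have "piece \<alpha> \<beta> dstar k = search_region \<alpha> \<beta> dstar \<inter>
      (\<Inter>i. {a. a $ k i \<le> ?d a i} \<inter>
           (if k i = last_index then UNIV else {a. ?d a i \<le> a $ Min {j. k i < j}}))"
    unfolding piece_def next_entry_def set_eq_iff by simp
  also have "polyhedron \<dots>"
    by (intro polyhedron_Int polyhedron_INT_finite polyhedron_search_region)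
       (simp_all add: polyhedron_nth_le_affine polyhedron_affine_le_nth del: vector_add_component)
  finally have "polyhedron (piece \<alpha> \<beta> dstar k)" .
  moreover have "bounded (piece \<alpha> \<beta> dstar k)"
    by (rule bounded_subset[OF bounded_search_region]) (auto simp: piece_def)
  ultimately show ?thesis by (simp add: polytope_eq_bounded_polyhedron)
qed

section \<open>Disjointness of interiors\<close>

text \<open>Two points on the line through a and the origin suffice: comparing the identity at a and
  at (1 - t) a for one small nonzero t cancels the linear parts and leaves t v_i = 0.\<close>

lemma affine_identity_open:
  fixes M :: "real^'n^'n"
  assumes "open U" "a \<in> U" "\<And>x. x \<in> U \<Longrightarrow> (M *v x + v) $ i = x $ m"
  shows "v $ i = 0"
proof -
  define f where "f = (\<lambda>t::real. (1 - t) *\<^sub>R a)"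
  have "f \<midarrow>0\<rightarrow> f 0"
    unfolding f_def by (intro isContD continuous_intros)
  moreover have "f 0 \<in> U" using assms(2) by (simp add: f_def)
  ultimately have "eventually (\<lambda>t. f t \<in> U) (at 0)"
    using assms(1) by (auto dest: topological_tendstoD)
  then obtain e where e: "e > 0" "\<And>t. t \<noteq> 0 \<Longrightarrow> dist t 0 < e \<Longrightarrow> f t \<in> U"
    unfolding eventually_at by blast
  define t where "t = e / 2"
  have t: "t \<noteq> 0" "f t \<in> U" using e by (auto simp: t_def)
  have "(1 - t) * (M *v a) $ i + v $ i = (1 - t) * a $ m"
    using assms(3)[OF t(2)] by (simp add: f_def matrix_vector_mult_scaleR)
  moreover have "(M *v a) $ i + v $ i = a $ m" using assms(3)[OF assms(2)] by simp
  ultimately have "t * v $ i = 0" by algebra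
  with t show ?thesis by simp
qed

text \<open>On the common interior the departure time of index i is squeezed onto an arrival time.
  An affine identity on an open set extends to the origin, where it contradicts eta > 0.\<close>

lemma interior_pieces_disjoint_less:
  fixes dstar :: "real^'n::{finite,linorder}"
  assumes "\<alpha> > 0" "\<alpha> * (real CARD('n) - 1) < \<beta>" "k \<in> K_set" "k' \<in> K_set" "k i < k' i"
  shows "interior (piece \<alpha> \<beta> dstar k) \<inter> interior (piece \<alpha> \<beta> dstar k') = {}"
proof (rule ccontr)
  let ?U = "interior (piece \<alpha> \<beta> dstar k) \<inter> interior (piece \<alpha> \<beta> dstar k')"
  assume "?U \<noteq> {}"
  then obtain a where a: "a \<in> ?U" by blast
  have "(Theta \<alpha> \<beta> k *v x + eta \<alpha> \<beta> k) $ i = x $ k' i" if "x \<in> ?U" for x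
  proof -
    have x: "x \<in> piece \<alpha> \<beta> dstar k" "x \<in> piece \<alpha> \<beta> dstar k'"
      using that interior_subset by blast+
    then have R: "x \<in> search_region \<alpha> \<beta> dstar" by (simp add: piece_def)
    have "Theta \<alpha> \<beta> k *v x + eta \<alpha> \<beta> k = Theta \<alpha> \<beta> k' *v x + eta \<alpha> \<beta> k'"
      using departure_piece[OF assms(1,2)] assms(3,4) x by metis
    moreover have "(Theta \<alpha> \<beta> k *v x + eta \<alpha> \<beta> k) $ i \<le> x $ k' i"
      using x(1) assms(5) unfolding piece_iff[OF R] by blast
    moreover have "x $ k' i \<le> (Theta \<alpha> \<beta> k' *v x + eta \<alpha> \<beta> k') $ i"
      using x(2) unfolding piece_iff[OF R] by blast
    ultimately show ?thesis by simp
  qed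
  then have "eta \<alpha> \<beta> k $ i = 0"
    using a by (intro affine_identity_open[of ?U]) auto
  with eta_pos[OF assms(1-3), of i] show False by simp
qed

lemma interior_pieces_disjoint:
  fixes dstar :: "real^'n::{finite,linorder}"
  assumes "\<alpha> > 0" "\<alpha> * (real CARD('n) - 1) < \<beta>" "k \<in> K_set" "k' \<in> K_set" "k \<noteq> k'"
  shows "interior (piece \<alpha> \<beta> dstar k) \<inter> interior (piece \<alpha> \<beta> dstar k') = {}"
proof -
  obtain i where "k i \<noteq> k' i" using assms(5) by blast
  then consider "k i < k' i" | "k' i < k i" by fastforce
  then show ?thesis
    using interior_pieces_disjoint_less[OF assms(1,2)] assms(3,4) by cases blast+
qed

section \<open>The cost on a piece\<close>

lemma cost_piece:
  fixes dstar :: "real^'n::{finite,linorder}"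
  assumes "\<alpha> > 0" "\<alpha> * (real CARD('n) - 1) < \<beta>" "k \<in> K_set" "a \<in> piece \<alpha> \<beta> dstar k"
  defines "d \<equiv> Theta \<alpha> \<beta> k *v a + eta \<alpha> \<beta> k"
  shows "cost \<alpha> \<beta> \<gamma> dstar a = (d - dstar) \<bullet> (d - dstar) + \<gamma> * (vec 1 \<bullet> (d - a))"
  unfolding cost_def departure_piece[OF assms(1-4)] d_def[symmetric]
  by (simp add: inner_vec_def sum.distrib sum_distrib_left power2_eq_square)

lemma cost_piece_quadratic:
  fixes dstar :: "real^'n::{finite,linorder}"
  assumes "\<alpha> > 0" "\<alpha> * (real CARD('n) - 1) < \<beta>" "k \<in> K_set" "a \<in> piece \<alpha> \<beta> dstar k"
  shows "cost \<alpha> \<beta> \<gamma> dstar a =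
    a \<bullet> (Q_mat \<alpha> \<beta> k *v a) + b_vec \<alpha> \<beta> \<gamma> dstar k \<bullet> a + b_const \<alpha> \<beta> \<gamma> dstar k"
proof -
  let ?T = "Theta \<alpha> \<beta> k" and ?e = "eta \<alpha> \<beta> k"
  \<comment> \<open>The quadratic part is the squared norm of Theta a; the remaining terms come from
    expanding the square of Theta a + (eta - dstar).\<close>
  have "a \<bullet> (Q_mat \<alpha> \<beta> k *v a) = (?T *v a) \<bullet> (?T *v a)"
    using dot_lmul_matrix[of "?T *v a" ?T a]
    by (simp add: Q_mat_def inner_commute flip: matrix_vector_mul_assoc)
  moreover have "b_vec \<alpha> \<beta> \<gamma> dstar k \<bullet> a =
      2 * ((?e - dstar) \<bullet> (?T *v a)) + \<gamma> * (vec 1 \<bullet> (?T *v a - a))"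
    by (simp add: b_vec_def inner_add_left dot_lmul_matrix matrix_vector_mult_diff_rdistrib)
  ultimately show ?thesis
    unfolding cost_piece[OF assms] b_const_def
    by (simp add: inner_add_left inner_add_right inner_diff_left inner_diff_right inner_commute algebra_simps)
qed

lemma convex_on_inner_affine:
  fixes M :: "real^'n^'m"
  assumes "convex S"
  shows "convex_on S (\<lambda>x. (M *v x + v) \<bullet> (M *v x + v))"
proof (rule convex_onI)
  fix t x y assume t: "0 < (t::real)" "t < 1"
  let ?p = "M *v x + v" and ?q = "M *v y + v"
  have "M *v ((1 - t) *\<^sub>R x + t *\<^sub>R y) + v = (1 - t) *\<^sub>R ?p + t *\<^sub>R ?q"
    by (simp add: matrix_vector_right_distrib matrix_vector_mult_scaleR algebra_simps)
  \<comment> \<open>The convexity gap of the squared norm is exactly t (1 - t) times the squared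
    distance of the two image points.\<close>
  moreover have "(1 - t) * (?p \<bullet> ?p) + t * (?q \<bullet> ?q) -
      ((1 - t) *\<^sub>R ?p + t *\<^sub>R ?q) \<bullet> ((1 - t) *\<^sub>R ?p + t *\<^sub>R ?q) =
      t * (1 - t) * ((?p - ?q) \<bullet> (?p - ?q))"
    by (simp only: inner_add_left inner_add_right inner_diff_left inner_diff_right
          inner_scaleR_left inner_scaleR_right inner_commute[of ?q ?p]) algebra
  moreover have "t * (1 - t) * ((?p - ?q) \<bullet> (?p - ?q)) \<ge> 0" using t by simp
  ultimately show "(M *v ((1 - t) *\<^sub>R x + t *\<^sub>R y) + v) \<bullet> (M *v ((1 - t) *\<^sub>R x + t *\<^sub>R y) + v)
      \<le> (1 - t) * (?p \<bullet> ?p) + t * (?q \<bullet> ?q)"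
    by simp
qed (rule assms)

lemma convex_on_cost_piece:
  fixes dstar :: "real^'n::{finite,linorder}"
  assumes "\<alpha> > 0" "\<alpha> * (real CARD('n) - 1) < \<beta>" "k \<in> K_set"
  shows "convex_on (piece \<alpha> \<beta> dstar k) (cost \<alpha> \<beta> \<gamma> dstar)"
proof -
  let ?P = "piece \<alpha> \<beta> dstar k"
  let ?T = "Theta \<alpha> \<beta> k" and ?e = "eta \<alpha> \<beta> k"
  let ?q = "\<lambda>a. (?T *v a + (?e - dstar)) \<bullet> (?T *v a + (?e - dstar))"
  let ?l = "\<lambda>a. \<gamma> * (vec 1 \<bullet> ((?T - mat 1) *v a + ?e))"
  have P: "convex ?P" by (rule polytope_imp_convex[OF polytope_piece])
  have "convex_on ?P ?l"
  proof (rule convex_onI)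
    fix t :: real and x y
    have "(?T - mat 1) *v ((1 - t) *\<^sub>R x + t *\<^sub>R y) + ?e =
        (1 - t) *\<^sub>R ((?T - mat 1) *v x + ?e) + t *\<^sub>R ((?T - mat 1) *v y + ?e)"
      by (simp add: matrix_vector_right_distrib matrix_vector_mult_scaleR algebra_simps)
    then have "?l ((1 - t) *\<^sub>R x + t *\<^sub>R y) = (1 - t) * ?l x + t * ?l y"
      by (simp only: inner_add_right inner_scaleR_right distrib_left mult.left_commute)
    then show "?l ((1 - t) *\<^sub>R x + t *\<^sub>R y) \<le> (1 - t) * ?l x + t * ?l y" by simp
  qed (rule P)
  then have c: "convex_on ?P (\<lambda>a. ?q a + ?l a)"
    by (intro convex_on_add convex_on_inner_affine P)
  have eq: "cost \<alpha> \<beta> \<gamma> dstar a = ?q a + ?l a" if "a \<in> ?P" for a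
    unfolding cost_piece[OF assms that]
    by (simp add: matrix_vector_mult_diff_rdistrib add_diff_eq diff_add_eq)
  show ?thesis
  proof (rule convex_onI)
    fix t x y assume *: "0 < (t::real)" "t < 1" "x \<in> ?P" "y \<in> ?P"
    \<comment> \<open>\<open>cost\<close> agrees with the convex formula only on the piece, so the
      combination must be known to lie there before the formula is substituted.\<close>
    then have "(1 - t) *\<^sub>R x + t *\<^sub>R y \<in> ?P" by (intro convexD[OF P]) auto
    with * show "cost \<alpha> \<beta> \<gamma> dstar ((1 - t) *\<^sub>R x + t *\<^sub>R y)
        \<le> (1 - t) * cost \<alpha> \<beta> \<gamma> dstar x + t * cost \<alpha> \<beta> \<gamma> dstar y"
      using convex_onD[OF c, of t x y] by (simp only: eq less_imp_le)
  qed (rule P)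
qed

theorem proposition4p1:
  fixes \<alpha> \<beta> \<gamma> :: real and dstar :: "real^'n::{finite,linorder}"
  assumes "\<alpha> > 0" and "\<beta> > 0" and "real CARD('n) < \<beta> / \<alpha> + 1"
    and "\<gamma> \<ge> 0" and "\<forall>i j. i \<le> j \<longrightarrow> dstar $ i \<le> dstar $ j"
  shows "search_region \<alpha> \<beta> dstar = (\<Union>k\<in>K_set. piece \<alpha> \<beta> dstar k) \<and>
    (\<forall>k\<in>K_set. polytope (piece \<alpha> \<beta> dstar k)) \<and>
    (\<forall>k\<in>K_set. \<forall>k'\<in>K_set. k \<noteq> k' \<longrightarrow>
       interior (piece \<alpha> \<beta> dstar k) \<inter> interior (piece \<alpha> \<beta> dstar k') = {}) \<and>
    (\<forall>k\<in>K_set. convex_on (piece \<alpha> \<beta> dstar k) (cost \<alpha> \<beta> \<gamma> dstar) \<and>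
       (\<forall>a\<in>piece \<alpha> \<beta> dstar k.
          cost \<alpha> \<beta> \<gamma> dstar a =
            a \<bullet> (Q_mat \<alpha> \<beta> k *v a) + b_vec \<alpha> \<beta> \<gamma> dstar k \<bullet> a + b_const \<alpha> \<beta> \<gamma> dstar k))"
proof -
  have \<beta>: "\<alpha> * (real CARD('n) - 1) < \<beta>"
    using assms(1,3) by (simp add: field_simps)
  have "search_region \<alpha> \<beta> dstar = (\<Union>k\<in>K_set. piece \<alpha> \<beta> dstar k)"
    using search_region_subset_pieces[OF assms(1) \<beta>, of _ dstar] by (auto simp: piece_def)
  then show ?thesis
    by (intro conjI ballI impI polytope_piece interior_pieces_disjoint[OF assms(1) \<beta>]
        convex_on_cost_piece[OF assms(1) \<beta>] cost_piece_quadratic[OF assms(1) \<beta>])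
qed

end
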